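(* Assume the axiom of choice, in the form: for all maps $P$ there exists a map $G$ such that $P\circ G\circ P=P$. Let $\Theta$ and $\mathcal{P}$ be sets and let $P:\Theta\to\mathcal{P}$ be a function (the forward mapping). Then the existence of a Fisher consistent estimator for $P$, i.e. of a function $T:\mathcal{P}\to\Theta$ with $T\circ P = 1_{\Theta}$, is equivalent to identifiability of $P$, i.e. to $P$ being injective.
   Context: $\Theta$ is an arbitrary set of "models" (an index set, possibly infinite-dimensional), and $\mathcal{P}$ is the set of all possible probability distributions over the observable random variables (or a convenient superset, such as the space of all finite signed measures). A forward mapping is a function $P:\Theta\to\mathcal{P}$, $\theta\mapsto\mathbb{P}_\theta$. A functional estimator (or simply estimator) is a function $T:\mathcal{P}\to\Theta$. The forward mapping $P$ is called identifiable iff it is injective: $P(\theta_1)=P(\theta_2)$ implies $\theta_1=\theta_2$; equivalently, it is left-cancellable: $P\circ G=P\circ H$ implies $G=H$ for all maps $G,H$ with common domain and with ranges in the domain of $P$. An estimator $T$ is called Fisher consistent for $P$ iff $T\circ P=1_{\Theta}$, where $1_\Theta$ is the identity map on $\Theta$. In the stated form of the axiom of choice, $G$ is a map in the opposite direction to $P$ and is called an inner inverse to $P$.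
   Formalization: The case of empty Θ with nonempty 𝒫 is excluded, both for the forward mapping and in the assumed form of choice: there the empty map is injective, yet no map from 𝒫 to Θ exists, so the equivalence and the existence of an inner inverse fail. *)

theory Defs
  imports "HOL-Library.FuncSet"
begin

text \<open>
  A map between sets \<open>A\<close> and \<open>B\<close> is an element of the extensional function space \<open>A \<rightarrow>\<^sub>E B\<close>,
  so that equality of such maps is HOL equality.  Identifiability of \<open>P\<close> is \<open>inj_on P \<Theta>\<close>.
\<close>

definition fisher_consistent :: "'a set \<Rightarrow> 'b set \<Rightarrow> ('a \<Rightarrow> 'b) \<Rightarrow> ('b \<Rightarrow> 'a) \<Rightarrow> bool" where
  "fisher_consistent \<Theta> \<P> P T \<longleftrightarrow> T \<in> \<P> \<rightarrow>\<^sub>E \<Theta> \<and> compose \<Theta> T P = (\<lambda>\<theta>\<in>\<Theta>. \<theta>)"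

definition inner_inverse :: "'a set \<Rightarrow> 'b set \<Rightarrow> ('a \<Rightarrow> 'b) \<Rightarrow> ('b \<Rightarrow> 'a) \<Rightarrow> bool" where
  "inner_inverse A B f g \<longleftrightarrow> g \<in> B \<rightarrow>\<^sub>E A \<and> compose A f (compose A g f) = f"

text \<open>
  The empty map into a nonempty set has no inner inverse, since there is no map back at all; every
  other map has one.  Hence a choice principle asserting inner inverses for all maps between sets
  is consistent only with the side condition \<open>A \<noteq> {} \<or> B = {}\<close>, and with it the principle holds in HOL.
\<close>

lemma ex_inner_inverse_iff:
  assumes f: "f \<in> A \<rightarrow>\<^sub>E B"
  shows "(\<exists>g. inner_inverse A B f g) \<longleftrightarrow> A \<noteq> {} \<or> B = {}"
proof
  assume "\<exists>g. inner_inverse A B f g"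
  then obtain g where "g \<in> B \<rightarrow>\<^sub>E A"
    unfolding inner_inverse_def by blast
  then show "A \<noteq> {} \<or> B = {}"
    using PiE_mem by fastforce
next
  assume ne: "A \<noteq> {} \<or> B = {}"
  define g where "g = (\<lambda>y\<in>B. if y \<in> f ` A then inv_into A f y else (SOME x. x \<in> A))"
  have "(if y \<in> f ` A then inv_into A f y else (SOME x. x \<in> A)) \<in> A" if "y \<in> B" for y
  proof (cases "y \<in> f ` A")
    case True
    then show ?thesis by (simp add: inv_into_into)
  next
    case False
    have "A \<noteq> {}" using ne that by auto
    then have "(SOME x. x \<in> A) \<in> A" by (simp add: some_in_eq)
    with False show ?thesis by (simp only: if_False)
  qed
  then have "g \<in> B \<rightarrow>\<^sub>E A"
    unfolding g_def by (simp only: restrict_PiE_iff) blast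
  moreover have "compose A f (compose A g f) = f"
  proof
    fix x
    show "compose A f (compose A g f) x = f x"
    proof (cases "x \<in> A")
      case True
      then have "f x \<in> B" using f by (rule PiE_mem[rotated])
      with True have "g (f x) = inv_into A f (f x)" by (simp add: g_def)
      with True show ?thesis by (simp add: compose_eq f_inv_into_f)
    next
      case False
      then show ?thesis by (simp add: compose_def PiE_arb[OF f])
    qed
  qed
  ultimately show "\<exists>g. inner_inverse A B f g"
    unfolding inner_inverse_def by blast
qed

end

theory Submission
  imports Defs
begin

text \<open>A left inverse of \<open>P\<close> on \<Theta> forces injectivity. Conversely, an inner
  inverse \<open>G\<close> satisfies P o G o P = P o 1, and an injective \<open>P\<close> can be
  cancelled on the left, leaving G o P = 1. So the inner inverse supplied by choice is itself the
  estimator.\<close>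

theorem theorem13:
  fixes \<Theta> :: "'a set" and \<P> :: "'b set" and P :: "'a \<Rightarrow> 'b"
  assumes choice: "\<And>(A :: 'a set) (B :: 'b set) f.
      A \<noteq> {} \<or> B = {} \<Longrightarrow> f \<in> A \<rightarrow>\<^sub>E B \<Longrightarrow> \<exists>g. inner_inverse A B f g"
    and nondegenerate: "\<Theta> \<noteq> {} \<or> \<P> = {}"
    and forward: "P \<in> \<Theta> \<rightarrow>\<^sub>E \<P>"
  shows "(\<exists>T. fisher_consistent \<Theta> \<P> P T) \<longleftrightarrow> inj_on P \<Theta>"
proof
  assume "\<exists>T. fisher_consistent \<Theta> \<P> P T"
  then obtain T where T: "compose \<Theta> T P = (\<lambda>\<theta>\<in>\<Theta>. \<theta>)"
    unfolding fisher_consistent_def by blast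
  have "T (P \<theta>) = \<theta>" if "\<theta> \<in> \<Theta>" for \<theta>
    using fun_cong[OF T, of \<theta>] that by (simp add: compose_eq)
  then show "inj_on P \<Theta>"
    by (rule inj_on_inverseI)
next
  assume inj: "inj_on P \<Theta>"
  \<comment> \<open>\<open>nondegenerate\<close> rules out the empty map into a nonempty set, which
    is injective but admits no map back at all.\<close>
  obtain G where G: "G \<in> \<P> \<rightarrow>\<^sub>E \<Theta>" and inner: "compose \<Theta> P (compose \<Theta> G P) = P"
    using choice[OF nondegenerate forward] unfolding inner_inverse_def by blast
  \<comment> \<open>Left cancellation, done pointwise; injectivity holds only on \<Theta>, so
    \<open>G (P \<theta>)\<close> must be known to lie there.\<close>
  have "G (P \<theta>) = \<theta>" if "\<theta> \<in> \<Theta>" for \<theta>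
  proof (rule inj_onD[OF inj])
    show "P (G (P \<theta>)) = P \<theta>"
      using fun_cong[OF inner, of \<theta>] that by (simp add: compose_eq)
    show "G (P \<theta>) \<in> \<Theta>"
      using G forward that by (blast dest: PiE_mem)
  qed (fact that)
  \<comment> \<open>Both maps are \<open>undefined\<close> off \<Theta>, so agreement on \<Theta>
    gives equality.\<close>
  then have "compose \<Theta> G P = (\<lambda>\<theta>\<in>\<Theta>. \<theta>)"
    unfolding compose_def by (rule restrict_ext)
  with G show "\<exists>T. fisher_consistent \<Theta> \<P> P T"
    unfolding fisher_consistent_def by blast
qed

end
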